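(* The essential height of an $l$-generated PI-algebra satisfying an admissible polynomial identity of degree $n$, over the set of words (in the generators) of length $<n$, is less than $$\Phi(n,l)=8(l+1)^{n+1}n^6.$$
   Context: Algebras are associative. An admissible polynomial identity of degree $n$ is, in the usual sense of Shirshov, a polynomial identity of degree $n$ in which some monomial of highest degree has coefficient $1$. Words are monomials in the $l$ generators. Essential height: an algebra $A$ has essential height $h$ over a finite set $Y\subset A$ if one can choose a finite set $D\subset A$ such that $A$ is linearly spanned by elements of the form $t_1t_2\cdots t_s$ with $s\le 2h+1$, where for each $i$ either $t_i\in D$ or $t_i=y_i^{k_i}$ with $y_i\in Y$, and the set of indices $i$ with $t_i\notin D$ has at most $h$ elements; the essential height is the least such $h$. *)

theory Defs
  imports Main "HOL-Library.Poly_Mapping" "HOL-Library.Extended_Nat"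
begin

(* Algebras are not assumed to have an identity element (as in Shirshov's setting), so the empty
   product does not exist: mult_list is only used on nonempty lists. *)
definition mult_list :: "'a::semigroup_mult list \<Rightarrow> 'a" where
  "mult_list xs = foldl (*) (hd xs) (tl xs)"

(* Only used for k > 0. *)
definition pos_power :: "'a::semigroup_mult \<Rightarrow> nat \<Rightarrow> 'a" where
  "pos_power x k = mult_list (replicate k x)"

definition words_less :: "(nat \<Rightarrow> 'a::semigroup_mult) \<Rightarrow> nat \<Rightarrow> nat \<Rightarrow> 'a set" where
  "words_less g l n =
     {mult_list (map g w) | w. w \<noteq> [] \<and> set w \<subseteq> {..<l} \<and> length w < n}"

(* Elements of the free associative algebra without 1 on variables indexed by nat: finitely
   supported functions on words, with no constant term. *)
definition nc_polynomial :: "(nat list \<Rightarrow>\<^sub>0 'r::zero) \<Rightarrow> bool" where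
  "nc_polynomial f \<longleftrightarrow> [] \<notin> Poly_Mapping.keys f"

definition nc_degree :: "(nat list \<Rightarrow>\<^sub>0 'r::zero) \<Rightarrow> nat" where
  "nc_degree f = Max (length ` Poly_Mapping.keys f)"

definition admissible :: "(nat list \<Rightarrow>\<^sub>0 'r::zero_neq_one) \<Rightarrow> bool" where
  "admissible f \<longleftrightarrow> nc_polynomial f \<and>
     (\<exists>w. length w = nc_degree f \<and> Poly_Mapping.lookup f w = 1)"

locale assoc_algebra = module scale
  for scale :: "'r::comm_ring_1 \<Rightarrow> 'a::ring \<Rightarrow> 'a" +
  assumes scale_mult_left: "scale c (x * y) = scale c x * y"
    and scale_mult_right: "scale c (x * y) = x * scale c y"
begin

definition subalgebra :: "'a set \<Rightarrow> bool" where
  "subalgebra S \<longleftrightarrow> subspace S \<and> (\<forall>x\<in>S. \<forall>y\<in>S. x * y \<in> S)"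

definition generated_by :: "'a set \<Rightarrow> bool" where
  "generated_by X \<longleftrightarrow> subalgebra hull X = UNIV"

definition nc_eval :: "(nat \<Rightarrow> 'a) \<Rightarrow> (nat list \<Rightarrow>\<^sub>0 'r) \<Rightarrow> 'a" where
  "nc_eval \<sigma> f =
     (\<Sum>w\<in>Poly_Mapping.keys f. scale (Poly_Mapping.lookup f w) (mult_list (map \<sigma> w)))"

definition polynomial_identity :: "(nat list \<Rightarrow>\<^sub>0 'r) \<Rightarrow> bool" where
  "polynomial_identity f \<longleftrightarrow> (\<forall>\<sigma>. nc_eval \<sigma> f = 0)"

definition height_products :: "'a set \<Rightarrow> 'a set \<Rightarrow> nat \<Rightarrow> 'a set" where
  "height_products Y D h =
     {mult_list ts | ts. ts \<noteq> [] \<and> length ts \<le> 2 * h + 1 \<and>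
        (\<forall>t\<in>set ts. t \<in> D \<or> (\<exists>y\<in>Y. \<exists>k>0. t = pos_power y k)) \<and>
        card {i. i < length ts \<and> ts ! i \<notin> D} \<le> h}"

definition has_essential_height :: "'a set \<Rightarrow> nat \<Rightarrow> bool" where
  "has_essential_height Y h \<longleftrightarrow>
     finite Y \<and> (\<exists>D. finite D \<and> span (height_products Y D h) = UNIV)"

(* The least h as above, and \<infinity> if there is none. *)
definition essential_height :: "'a set \<Rightarrow> enat" where
  "essential_height Y = (INF h\<in>{h. has_essential_height Y h}. enat h)"

end

end

theory Submission
  imports Defs "HOL-Library.Sublist" "HOL-Library.List_Lexorder"
begin

text \<open>
  Linearizing the identity expresses a product \<open>a\<^sub>1 \<dots> a\<^sub>n\<close> through its nontrivial permutations, so a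
  word containing consecutive factors \<open>w\<^sub>1 > \<dots> > w\<^sub>n\<close> (lexicographically, none a prefix of another) is a
  combination of smaller words, and the algebra is spanned by the words without such factors.

  If \<open>n\<close> distinct factors of one length \<open>m\<close> recur throughout a word, choosing them in decreasing order
  makes it divisible; if a word has fewer than \<open>n\<close> factors of length \<open>m\<close>, two of its first \<open>n\<close> ones
  coincide, which produces a period less than \<open>n\<close>. Hence an indivisible word splits into pieces of
  bounded length and maximal powers \<open>u\<^sup>j\<close> with \<open>|u| < n < j\<close>. If such a power is followed by \<open>r < u\<close>, then
  \<open>u\<^sup>i r\<close> increases with \<open>i\<close>, even when \<open>r\<close> varies; if \<open>r > u\<close>, it decreases. Therefore \<open>n\<close> powers of the
  same \<open>u\<close> breaking off to the same side make the word divisible, so their number is at most \<open>2 n\<close>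
  times the number of words \<open>u\<close>, plus one for the last power.
\<close>

section \<open>Divisible words\<close>

text \<open>Asking for a genuine first difference excludes prefixes, so the comparison survives
  arbitrary extensions to the right, unlike the list order \<open><\<close>.\<close>

definition lex_below :: "nat list \<Rightarrow> nat list \<Rightarrow> bool" where
  "lex_below v w \<longleftrightarrow> (\<exists>p a b v' w'. v = p @ a # v' \<and> w = p @ b # w' \<and> a < b)"

text \<open>Shirshov's n-divisibility. Gaps and a tail are not mentioned, since each factor can
  absorb what follows it.\<close>

definition divisible :: "nat \<Rightarrow> nat list \<Rightarrow> bool" where
  "divisible n W \<longleftrightarrow> (\<exists>d ws. W = d @ concat ws \<and> length ws = n \<and> [] \<notin> set ws \<and>
     sorted_wrt (\<lambda>x y. lex_below y x) ws)"

lemma lex_below_append: "lex_below v w \<Longrightarrow> lex_below (p @ v @ x) (p @ w @ y)"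
  unfolding lex_below_def by (metis append.assoc append_Cons)

lemma lex_below_prefix: "lex_below v w \<Longrightarrow> prefix v v' \<Longrightarrow> prefix w w' \<Longrightarrow> lex_below v' w'"
  using lex_below_append[of v w "[]"] by (auto simp: prefix_def)

lemma lex_below_nonempty: "lex_below v w \<Longrightarrow> v \<noteq> [] \<and> w \<noteq> []"
  by (auto simp: lex_below_def)

lemma lex_below_imp_lex:
  "lex_below v w \<Longrightarrow> length v = length w \<Longrightarrow> (v, w) \<in> lex less_than"
  unfolding lex_below_def lex_conv by auto

lemma lex_below_of_less:
  fixes v w :: "nat list"
  assumes "v < w" "length v = length w"
  shows "lex_below v w"
  using assms unfolding list_less_def lexord_def lex_below_def by auto

lemma lex_below_linear:
  assumes "\<not> prefix u R" "length u \<le> length R"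
  shows "lex_below R u \<or> lex_below u R"
proof -
  have "\<not> prefix R u"
    using assms by (auto simp: prefix_def)
  with assms(1) have "R \<parallel> u" by auto
  then obtain p b bs c cs where *: "b \<noteq> c" "R = p @ b # bs" "u = p @ c # cs"
    using parallel_decomp by blast
  then have "b < c \<or> c < b" by auto
  then show ?thesis using * unfolding lex_below_def by blast
qed

section \<open>Disjoint factors in a given order, with gaps\<close>

fun scattered :: "nat list list \<Rightarrow> nat list \<Rightarrow> bool" where
  "scattered [] W \<longleftrightarrow> True"
| "scattered (s # ss) W \<longleftrightarrow> (\<exists>x y. W = x @ s @ y \<and> scattered ss y)"

lemma scattered_prepend: "scattered ss W \<Longrightarrow> scattered ss (x @ W)"
  by (cases ss) (auto, metis append.assoc)

lemma scattered_drop: "scattered ss (drop q W) \<Longrightarrow> scattered ss W"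
  using scattered_prepend[of ss "drop q W" "take q W"] by simp

text \<open>The first gap becomes \<open>d\<close>; every later gap, and the tail, goes into the
  factor before it.\<close>

lemma scattered_extend:
  "scattered ss W \<Longrightarrow> \<exists>d ws. W = d @ concat ws \<and> list_all2 prefix ss ws"
proof (induction ss arbitrary: W)
  case Nil
  show ?case by (intro exI[of _ W] exI[of _ "[]"]) simp
next
  case (Cons s ss)
  then obtain x y where W: "W = x @ s @ y" and "scattered ss y" by auto
  with Cons.IH obtain d ws where "y = d @ concat ws" "list_all2 prefix ss ws" by blast
  with W show ?case by (intro exI[of _ x] exI[of _ "(s @ d) # ws"]) simp
qed

lemma scattered_divisible:
  assumes "scattered ss W" "[] \<notin> set ss" "sorted_wrt (\<lambda>x y. lex_below y x) ss"
  shows "divisible (length ss) W"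
proof -
  obtain d ws where W: "W = d @ concat ws" and pre: "list_all2 prefix ss ws"
    using scattered_extend[OF assms(1)] by blast
  have len: "length ws = length ss" using pre by (simp add: list_all2_lengthD)
  have nth: "prefix (ss ! i) (ws ! i)" if "i < length ss" for i
    using pre that by (simp add: list_all2_nthD)
  have "[] \<notin> set ws"
    using nth assms(2) len by (metis in_set_conv_nth prefix_bot.extremum_uniqueI)
  moreover have "sorted_wrt (\<lambda>x y. lex_below y x) ws"
    using assms(3) nth len unfolding sorted_wrt_iff_nth_less
    by (auto intro!: lex_below_prefix[OF _ nth nth])
  ultimately show ?thesis unfolding divisible_def using W len by blast
qed

lemma divisible_sublist:
  assumes "divisible n B" "sublist B W"
  shows "divisible n W"
proof -
  obtain x y where W: "W = x @ B @ y" using assms(2) by (auto simp: sublist_def)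
  obtain d ws where B: "B = d @ concat ws" "length ws = n" "[] \<notin> set ws"
    "sorted_wrt (\<lambda>x y. lex_below y x) ws" using assms(1) unfolding divisible_def by blast
  have "scattered ws (concat ws @ y)" for y
    by (induction ws) (simp, metis append.assoc append_Nil concat.simps(2) scattered.simps(2))
  then have "scattered ws W"
    unfolding W B(1) using scattered_prepend by simp
  then show ?thesis using scattered_divisible B by blast
qed

section \<open>Long words are divisible or contain powers\<close>

definition factors :: "nat \<Rightarrow> nat list \<Rightarrow> nat list set" where
  "factors m W = {v. length v = m \<and> sublist v W}"

abbreviation word_power :: "'b list \<Rightarrow> nat \<Rightarrow> 'b list" where
  "word_power u k \<equiv> concat (replicate k u)"

lemma factors_words: "factors m W \<subseteq> {v. set v \<subseteq> set W \<and> length v = m}"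
  by (auto simp: factors_def dest: set_mono_sublist)

lemma finite_factors: "finite (factors m W)"
  by (rule finite_subset[OF factors_words]) (simp add: finite_lists_length_eq)

lemma factors_mono: "sublist B W \<Longrightarrow> factors m B \<subseteq> factors m W"
  by (auto simp: factors_def intro: sublist_order.order.trans)

text \<open>Agreement with the shift by \<open>t\<close> means period \<open>t\<close>, so each
  block of \<open>t\<close> letters repeats the one before.\<close>

lemma power_of_period:
  "take m X = take m (drop t X) \<Longrightarrow> k * t \<le> m \<Longrightarrow> take (k * t) X = word_power (take t X) k"
proof (induction k)
  case (Suc k)
  have "take (k * t) (drop t X) = take (k * t) (take m (drop t X))"
    using Suc.prems(2) by (simp add: min_def)
  also have "\<dots> = take (k * t) X"
    using Suc.prems by (metis add_leD2 min.absorb1 mult_Suc take_take)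
  finally show ?case using Suc by (simp add: take_add)
qed simp

text \<open>Pigeonhole: two of the factors starting at positions \<open>0\<close> to
  \<open>n - 1\<close> coincide. Their distance is a period less than \<open>n\<close>, and the
  length \<open>n * k\<close> has room for \<open>k\<close> such periods.\<close>

lemma few_factors_power:
  assumes "card (factors (n * k) W) < n" "n * k + n \<le> length W"
  shows "\<exists>u. u \<noteq> [] \<and> length u < n \<and> sublist (word_power u k) W"
proof -
  let ?m = "n * k" and ?F = "\<lambda>i. take (n * k) (drop i W)"
  have "?F i \<in> factors ?m W" if "i < n" for i
  proof -
    have "length (?F i) = ?m" using assms(2) that by simp
    moreover have "sublist (?F i) W"
      using sublist_take sublist_drop by (rule sublist_order.order.trans)
    ultimately show ?thesis unfolding factors_def by blast
  qed
  then have "?F ` {..<n} \<subseteq> factors ?m W" by blast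
  then have "card (?F ` {..<n}) \<le> card (factors ?m W)" by (rule card_mono[OF finite_factors])
  then have "card {..<n} > card (?F ` {..<n})" using assms(1) by simp
  then have "\<not> inj_on ?F {..<n}" by (rule pigeonhole)
  then obtain i j where ij: "i < j" "j < n" "?F i = ?F j"
    unfolding inj_on_def by (metis lessThan_iff linorder_neqE_nat)
  define X where "X = drop i W"
  have "take ?m X = take ?m (drop (j - i) X)" using ij by (simp add: X_def)
  moreover have "k * (j - i) \<le> ?m"
    by (subst mult.commute[of n], rule mult_le_mono2) (use ij in simp)
  ultimately have "take (k * (j - i)) X = word_power (take (j - i) X) k"
    by (rule power_of_period)
  then have "sublist (word_power (take (j - i) X) k) W"
    by (metis X_def sublist_drop sublist_order.order.trans sublist_take)
  moreover have "length (take (j - i) X) = j - i" using ij assms(2) by (simp add: X_def)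
  ultimately show ?thesis using ij by (intro exI[of _ "take (j - i) X"]) auto
qed

text \<open>The word is cut into consecutive windows of length \<open>N\<close>, and each entry of
  \<open>ss\<close> is taken from its own window; so any order of the entries can be
  realized.\<close>

lemma scattered_of_recurrent:
  assumes "\<And>B. sublist B W \<Longrightarrow> length B = N \<Longrightarrow> F \<subseteq> factors m B"
    and "set ss \<subseteq> F" "length ss * N \<le> length W"
  shows "scattered ss W"
  using assms
proof (induction ss arbitrary: W)
  case (Cons s ss)
  have "F \<subseteq> factors m (take N W)" using Cons.prems by simp
  then have "sublist s (take N W)" using Cons.prems(2) by (auto simp: factors_def)
  then obtain x y where xy: "take N W = x @ s @ y" by (auto simp: sublist_def)
  have "scattered ss (drop N W)"
    using Cons.prems
    by (intro Cons.IH) (auto dest: sublist_order.order.trans[OF _ sublist_drop])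
  then have "scattered ss (y @ drop N W)" by (rule scattered_prepend)
  moreover have "W = x @ s @ y @ drop N W"
    using xy by (metis append.assoc append_take_drop_id)
  ultimately show ?case by auto
qed simp

text \<open>Induction on the number of factors: unless some window of length \<open>N\<close> misses a factor, every
  factor recurs in each of \<open>n\<close> consecutive windows.\<close>

lemma divisible_or_power_card:
  assumes "0 < k"
  shows "\<exists>N. \<forall>W. card (factors (n * k) W) \<le> s \<and> N \<le> length W \<longrightarrow>
     divisible n W \<or> (\<exists>u. u \<noteq> [] \<and> length u < n \<and> sublist (word_power u k) W)"
proof (cases "n = 0")
  case True
  then show ?thesis by (auto simp: divisible_def)
next
  case False
  show ?thesis
  proof (induction s)
    case 0
    then show ?case using False by (intro exI[of _ "n * k + n"]) (auto intro!: few_factors_power)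
  next
    case (Suc s)
    let ?m = "n * k"
    let ?Q = "\<lambda>W. divisible n W \<or> (\<exists>u. u \<noteq> [] \<and> length u < n \<and> sublist (word_power u k) W)"
    obtain N where N: "\<And>W. card (factors ?m W) \<le> s \<Longrightarrow> N \<le> length W \<Longrightarrow> ?Q W"
      using Suc by blast
    have Q_mono: "?Q W" if "?Q B" "sublist B W" for B W
      using that divisible_sublist sublist_order.order.trans by blast
    \<comment> \<open>The first bound leaves room for \<open>n\<close> windows of length
      \<open>N\<close>; the second is the one in \<open>few_factors_power\<close>.\<close>
    have "?Q W" if W: "card (factors ?m W) \<le> Suc s" "max (n * N) (n * k + n) \<le> length W" for W
    proof -
      consider "card (factors ?m W) < n"
        | B where "sublist B W" "length B = N" "card (factors ?m B) \<le> s"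
        | "n \<le> card (factors ?m W)"
          "\<And>B. sublist B W \<Longrightarrow> length B = N \<Longrightarrow> s < card (factors ?m B)"
        by (meson not_le)
      then show ?thesis
      proof cases
        case 1
        then show ?thesis using few_factors_power W by auto
      next
        case 2
        then show ?thesis using N[of B] Q_mono[of B W] by auto
      next
        case 3
        \<comment> \<open>A window with more than \<open>s\<close> factors, inside a word with at
          most \<open>Suc s\<close>, has all of them.\<close>
        have rec: "factors ?m W \<subseteq> factors ?m B" if "sublist B W" "length B = N" for B
        proof -
          have "card (factors ?m W) \<le> card (factors ?m B)" using 3(2)[OF that] W(1) by simp
          then show ?thesis
            using card_seteq[OF finite_factors factors_mono[OF that(1)]] by blast
        qed
        obtain T where T: "T \<subseteq> factors ?m W" "card T = n" "finite T"
          using 3(1) by (meson obtain_subset_with_card_n)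
        \<comment> \<open>Distinct words of equal length are not prefixes of one another, so
          decreasing list order is decreasing for \<open>lex_below\<close>.\<close>
        define ss where "ss = rev (sorted_list_of_set T)"
        have set: "set ss = T" and len: "length ss = n" using T by (auto simp: ss_def)
        have "scattered ss W"
          using scattered_of_recurrent[of W N "factors ?m W" ?m ss] rec T set len W(2) by auto
        moreover have "sorted_wrt (\<lambda>x y. lex_below y x) ss"
        proof -
          have "sorted_wrt (\<lambda>x y. y < x) ss"
            unfolding ss_def sorted_wrt_rev by (simp add: strict_sorted_list_of_set)
          moreover have "length x = ?m" if "x \<in> set ss" for x
            using that T(1) set by (auto simp: factors_def)
          ultimately show ?thesis
            using sorted_wrt_mono_rel[of ss "\<lambda>x y. y < x" "\<lambda>x y. lex_below y x"]
            by (simp add: lex_below_of_less)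
        qed
        moreover have "[] \<notin> set ss"
          using T(1) set \<open>0 < k\<close> False by (auto simp: factors_def)
        ultimately show ?thesis using scattered_divisible len by blast
      qed
    qed
    then show ?case by blast
  qed
qed

text \<open>The number of words of length \<open>n * k\<close> over \<open>l\<close> letters bounds
  the number of factors, which makes \<open>N\<close> uniform in \<open>W\<close>.\<close>

lemma divisible_or_power:
  assumes "0 < k"
  shows "\<exists>N. \<forall>W. set W \<subseteq> {..<l} \<and> N \<le> length W \<longrightarrow>
     divisible n W \<or> (\<exists>u. u \<noteq> [] \<and> length u < n \<and> sublist (word_power u k) W)"
proof -
  let ?L = "{v. set v \<subseteq> {..<l} \<and> length v = n * k}"
  have "finite ?L" by (simp add: finite_lists_length_eq)
  then have "card (factors (n * k) W) \<le> card ?L" if "set W \<subseteq> {..<l}" for W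
    using that factors_words[of "n * k" W] by (intro card_mono) auto
  then show ?thesis using divisible_or_power_card[OF assms, of n "card ?L"] by blast
qed

section \<open>Periodic fragments of indivisible words\<close>

fun glue :: "('b list \<times> 'b list \<times> nat) list \<Rightarrow> 'b list \<Rightarrow> 'b list" where
  "glue [] e = e"
| "glue ((d, u, j) # ts) e = d @ word_power u j @ glue ts e"

text \<open>The prefix condition says that the power is maximal to the right: the remainder does not
  begin with another copy of \<open>u\<close>.\<close>

fun fragmented :: "nat \<Rightarrow> nat \<Rightarrow> nat \<Rightarrow> ('b list \<times> 'b list \<times> nat) list \<Rightarrow> 'b list \<Rightarrow> bool" where
  "fragmented N n k [] e \<longleftrightarrow> length e \<le> N"
| "fragmented N n k ((d, u, j) # ts) e \<longleftrightarrow> length d \<le> N \<and> u \<noteq> [] \<and> length u < n \<and> k \<le> j \<and>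
     \<not> prefix u (glue ts e) \<and> fragmented N n k ts e"

lemma length_word_power: "length (word_power u j) = j * length u"
  by (induction j) auto

lemma maximal_power:
  assumes "u \<noteq> []"
  shows "\<exists>j R'. word_power u k @ R = word_power u j @ R' \<and> k \<le> j \<and> \<not> prefix u R'"
proof (induction "length R" arbitrary: k R rule: less_induct)
  case less
  show ?case
  proof (cases "prefix u R")
    case True
    then obtain R' where R: "R = u @ R'" by (auto simp: prefix_def)
    have "word_power u k @ u = word_power u (Suc k)" by (induction k) auto
    then have "word_power u k @ R = word_power u (Suc k) @ R'"
      using R by (metis append.assoc)
    moreover have "length R' < length R" using R assms by simp
    ultimately show ?thesis using less[of R' "Suc k"] by (metis Suc_leD)
  qed blast
qed

text \<open>The first \<open>N\<close> letters contain a power, which is prolonged beyond them as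
  far as possible; the remainder is shorter and, as a factor of \<open>W\<close>, again
  indivisible.\<close>

lemma fragmented_exists:
  assumes N: "\<And>W. set W \<subseteq> {..<l} \<Longrightarrow> N \<le> length W \<Longrightarrow>
     divisible n W \<or> (\<exists>u. u \<noteq> [] \<and> length u < n \<and> sublist (word_power u k) W)"
    and "0 < k" "set W \<subseteq> {..<l}" "\<not> divisible n W"
  shows "\<exists>ts e. W = glue ts e \<and> fragmented N n k ts e"
  using assms(3,4)
proof (induction "length W" arbitrary: W rule: less_induct)
  case less
  show ?case
  proof (cases "length W \<le> N")
    case True
    then show ?thesis by (intro exI[of _ "[]"] exI[of _ W]) simp
  next
    case False
    have "\<not> divisible n (take N W)" using less.prems(2) divisible_sublist sublist_take by blast
    moreover have "set (take N W) \<subseteq> {..<l}" using less.prems(1) by (meson order_trans set_take_subset)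
    ultimately obtain u where u: "u \<noteq> []" "length u < n" "sublist (word_power u k) (take N W)"
      using N[of "take N W"] False by auto
    then obtain d y where d: "take N W = d @ word_power u k @ y" by (auto simp: sublist_def)
    have "length d \<le> length (take N W)" unfolding d by simp
    then have "length d \<le> N" by simp
    obtain j R where j: "word_power u k @ y @ drop N W = word_power u j @ R" "k \<le> j"
      "\<not> prefix u R"
      using maximal_power[OF u(1)] by blast
    have W: "W = d @ word_power u j @ R"
      using d j(1) by (metis append.assoc append_take_drop_id)
    have "0 < j * length u" using u(1) j(2) \<open>0 < k\<close> by simp
    then have "length R < length W" unfolding W by (simp add: length_word_power)
    moreover have "set R \<subseteq> {..<l}" using less.prems(1) W by simp
    moreover have "sublist R W" unfolding W by (metis append.assoc sublist_append_leftI)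
    then have "\<not> divisible n R" using less.prems(2) divisible_sublist by blast
    ultimately obtain ts e where "R = glue ts e" "fragmented N n k ts e"
      using less.hyps by blast
    then show ?thesis
      using W u \<open>length d \<le> N\<close> j by (intro exI[of _ "(d, u, j) # ts"] exI[of _ e]) simp
  qed
qed

section \<open>Types of fragments and their number\<close>

text \<open>The Boolean records on which side of \<open>u\<^sup>\<infinity>\<close> the word falls once its period breaks off. Only
  the last fragment can fail to have a type, as its remainder may be a proper prefix of \<open>u\<close>.\<close>

fun fragment_types :: "(nat list \<times> nat list \<times> nat) list \<Rightarrow> nat list \<Rightarrow> (nat list \<times> bool) list" where
  "fragment_types [] e = []"
| "fragment_types ((d, u, j) # ts) e =
     (if lex_below (glue ts e) u then [(u, True)]
      else if lex_below u (glue ts e) then [(u, False)] else []) @ fragment_types ts e"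

text \<open>After any fragment but the last comes another power, so the remainder has length at
  least \<open>n\<close>, more than \<open>u\<close>, and \<open>lex_below_linear\<close> gives it a
  type.\<close>

lemma length_fragment_types:
  "fragmented N n (Suc n) ts e \<Longrightarrow> length ts \<le> length (fragment_types ts e) + 1"
proof (induction ts)
  case (Cons t ts)
  obtain d u j where t: "t = (d, u, j)" by (cases t)
  show ?case
  proof (cases ts)
    case (Cons t' ts')
    obtain d' u' j' where t': "t' = (d', u', j')" by (cases t')
    have "1 \<le> length u'" "n < j'"
      using Cons.prems unfolding t t' Cons by (auto simp: Suc_le_eq)
    then have "n \<le> j' * length u'" by (metis less_imp_le mult.right_neutral mult_le_mono)
    then have "n \<le> length (glue ts e)" unfolding Cons t' by (simp add: length_word_power)
    then have "lex_below (glue ts e) u \<or> lex_below u (glue ts e)"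
      using Cons.prems unfolding t by (intro lex_below_linear) auto
    then show ?thesis using Cons.IH Cons.prems unfolding t by auto
  qed (simp add: t)
qed simp

definition breaks :: "nat list \<Rightarrow> bool \<Rightarrow> nat list \<Rightarrow> bool" where
  "breaks u b r \<longleftrightarrow> (if b then lex_below r u else lex_below u r)"

text \<open>The cut is made right after the first letter that differs from \<open>u\<close>.\<close>

lemma breaks_prefix:
  assumes "breaks u b R"
  shows "\<exists>r y. R = r @ y \<and> length r \<le> length u \<and> breaks u b r"
proof -
  obtain p x z R' u' where *: "R = p @ x # R'" "u = p @ z # u'" "if b then x < z else z < x"
    using assms unfolding breaks_def lex_below_def by (cases b) auto
  then have "breaks u b (p @ [x])" unfolding breaks_def lex_below_def by (cases b) auto
  with * show ?thesis by (intro exI[of _ "p @ [x]"] exI[of _ R']) auto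
qed

lemma fragment_types_Cons:
  assumes "(u, b) \<in> set (fragment_types [(d, v, j)] (glue ts e))"
  shows "v = u" "breaks u b (glue ts e)"
  using assms by (auto simp: breaks_def split: if_splits)

text \<open>Dropping \<open>length u\<close> letters makes room for the break of the preceding fragment, which may reach
  into the first period of the next one.\<close>

lemma scattered_fragments:
  assumes "fragmented N n (Suc n) ts e" "\<forall>a\<in>set as. a < n"
    and "length as \<le> count_list (fragment_types ts e) (u, b)" "length u < n"
  shows "\<exists>rs. length rs = length as \<and> (\<forall>r\<in>set rs. breaks u b r) \<and>
     scattered (map2 (\<lambda>a r. word_power u a @ r) as rs) (drop (length u) (glue ts e))"
  using assms(1-3)
proof (induction ts arbitrary: as)
  case Nil
  then show ?case by simp
next
  case (Cons t ts)
  obtain d v j where t: "t = (d, v, j)" by (cases t)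
  let ?R = "glue ts e"
  have frag: "fragmented N n (Suc n) ts e" "n < j" "v \<noteq> []" using Cons.prems(1) t by auto
  show ?case
  proof (cases "\<exists>a as'. as = a # as' \<and> v = u \<and> breaks u b ?R")
    case True
    then obtain a as' where as: "as = a # as'" and "v = u" and br: "breaks u b ?R" by blast
    obtain r y where r: "?R = r @ y" "length r \<le> length u" "breaks u b r"
      using breaks_prefix[OF br] by blast
    have "count_list (fragment_types (t # ts) e) (u, b) \<le> Suc (count_list (fragment_types ts e) (u, b))"
      by (simp add: t)
    then obtain rs where rs: "length rs = length as'" "\<forall>r\<in>set rs. breaks u b r"
      "scattered (map2 (\<lambda>a r. word_power u a @ r) as' rs) (drop (length u) ?R)"
      using Cons.IH[of as'] Cons.prems frag as by auto
    \<comment> \<open>The break \<open>r\<close> uses at most \<open>length u\<close> letters of the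
      remainder, so the factors found beyond those letters lie in \<open>y\<close>.\<close>
    have "drop (length u) ?R = drop (length u - length r) y" using r by simp
    then have sc: "scattered (map2 (\<lambda>a r. word_power u a @ r) as' rs) y"
      using rs(3) by (metis scattered_drop)
    have "a < n" using Cons.prems as by simp
    \<comment> \<open>The last \<open>a\<close> copies of \<open>u\<close> form the new factor; as
      \<open>a < n < j\<close>, a copy in front of them is left for the dropped letters.\<close>
    then have "j = Suc (j - 1 - a) + a" using frag by simp
    then have "word_power u j = u @ word_power u (j - 1 - a) @ word_power u a"
      by (metis append.assoc concat.simps(2) concat_append replicate_Suc replicate_add)
    then have "drop (length u) (glue (t # ts) e) =
      (drop (length u) (d @ u) @ word_power u (j - 1 - a)) @ (word_power u a @ r) @ y"
      using r(1) \<open>v = u\<close> t by simp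
    then have "scattered ((word_power u a @ r) # map2 (\<lambda>a r. word_power u a @ r) as' rs)
      (drop (length u) (glue (t # ts) e))"
      using sc scattered.simps(2) by blast
    with rs r as show ?thesis by (intro exI[of _ "r # rs"]) simp
  next
    case False
    have "\<exists>rs. length rs = length as \<and> (\<forall>r\<in>set rs. breaks u b r) \<and>
      scattered (map2 (\<lambda>a r. word_power u a @ r) as rs) (drop (length u) ?R)"
    proof (cases as)
      case (Cons a as')
      have "(u, b) \<notin> set (fragment_types [t] ?R)"
      proof
        assume "(u, b) \<in> set (fragment_types [t] ?R)"
        then have "v = u" "breaks u b ?R" unfolding t by (rule fragment_types_Cons)+
        then show False using False Cons by blast
      qed
      moreover have "fragment_types (t # ts) e = fragment_types [t] ?R @ fragment_types ts e"
        by (simp add: t)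
      ultimately have "count_list (fragment_types (t # ts) e) (u, b)
          = count_list (fragment_types ts e) (u, b)"
        by (metis add_0 count_list_append count_notin)
      then have "length as \<le> count_list (fragment_types ts e) (u, b)" using Cons.prems(3) by simp
      with frag(1) Cons.prems(2) show ?thesis by (rule Cons.IH)
    qed simp
    \<comment> \<open>The dropped letters lie inside the skipped fragment, so the whole remainder is
      still available.\<close>
    moreover have "length u \<le> length (d @ word_power v j)"
    proof -
      have "n * 1 \<le> j * length v" using frag by (intro mult_le_mono) (auto simp: Suc_le_eq)
      then show ?thesis using assms(4) by (simp add: length_word_power)
    qed
    then have "drop (length u) (glue (t # ts) e) = drop (length u) (d @ word_power v j) @ ?R"
      by (simp add: t)
    ultimately show ?thesis by (metis scattered_drop scattered_prepend)
  qed
qed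

text \<open>After the common \<open>word_power u i\<close> one word continues with \<open>r\<close>
  and the other with \<open>u\<close>, so the first difference between \<open>r\<close> and
  \<open>u\<close> decides.\<close>

lemma lex_below_powers:
  assumes "i < j"
  shows "lex_below r u \<Longrightarrow> lex_below (word_power u i @ r) (word_power u j @ r')"
    and "lex_below u r \<Longrightarrow> lex_below (word_power u j @ r') (word_power u i @ r)"
proof -
  have "j = i + Suc (j - i - 1)" using assms by simp
  then have j: "word_power u j @ r' = word_power u i @ u @ (word_power u (j - i - 1) @ r')"
    by (metis append.assoc concat.simps(2) concat_append replicate_Suc replicate_add)
  show "lex_below r u \<Longrightarrow> lex_below (word_power u i @ r) (word_power u j @ r')"
    using lex_below_append[of r u "word_power u i" "[]"] j by simp
  show "lex_below u r \<Longrightarrow> lex_below (word_power u j @ r') (word_power u i @ r)"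
    using lex_below_append[of u r "word_power u i" _ "[]"] j by simp
qed

text \<open>All exponents exceed \<open>n\<close>, so the \<open>n\<close> fragments can be
  shortened to any prescribed exponents below \<open>n\<close>, in any order.\<close>

lemma count_fragment_types:
  assumes "fragmented N n (Suc n) ts e" "\<not> divisible n (glue ts e)" "length u < n"
  shows "count_list (fragment_types ts e) (u, b) < n"
proof (rule ccontr)
  \<comment> \<open>With breaks below \<open>u\<close> larger exponents give larger words, with
    breaks above \<open>u\<close> smaller ones; either listing makes the factors decrease.\<close>
  define as where "as = (if b then rev [0..<n] else [0..<n])"
  have len: "length as = n" and "\<forall>a\<in>set as. a < n" by (auto simp: as_def)
  moreover assume "\<not> ?thesis"
  ultimately obtain rs where rs: "length rs = n" "\<forall>r\<in>set rs. breaks u b r"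
    and "scattered (map2 (\<lambda>a r. word_power u a @ r) as rs) (drop (length u) (glue ts e))"
    using scattered_fragments[OF assms(1), of as u b] assms(3) by auto
  then have "scattered (map2 (\<lambda>a r. word_power u a @ r) as rs) (glue ts e)" (is "scattered ?ss _")
    by (simp add: scattered_drop)
  \<comment> \<open>For exponent 0 the factor is just the break, which is nonempty because it
    contains a first difference.\<close>
  moreover have "[] \<notin> set ?ss"
    using rs(2) lex_below_nonempty by (auto simp: breaks_def dest!: set_zip_rightD split: if_splits)
  moreover have "sorted_wrt (\<lambda>x y. lex_below y x) ?ss"
    unfolding sorted_wrt_iff_nth_less
  proof (intro allI impI)
    fix i j assume ij: "i < j" "j < length ?ss"
    then have j: "j < n" using rs len by simp
    have "breaks u b (rs ! i)" "breaks u b (rs ! j)" using rs ij j by auto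
    then show "lex_below (?ss ! j) (?ss ! i)"
      using ij j rs len lex_below_powers[of "as ! i" "as ! j"] lex_below_powers[of "as ! j" "as ! i"]
      by (cases b) (auto simp: as_def breaks_def rev_nth)
  qed
  ultimately have "divisible (length ?ss) (glue ts e)" by (rule scattered_divisible)
  then show False using assms(2) rs len by simp
qed

lemma set_fragment_types:
  "fragmented N n k ts e \<Longrightarrow> set (glue ts e) \<subseteq> A \<Longrightarrow> 0 < k \<Longrightarrow>
    set (fragment_types ts e) \<subseteq> {u. set u \<subseteq> A \<and> length u \<le> n - 1} \<times> UNIV"
  by (induction ts e rule: fragment_types.induct) auto

text \<open>The left side counts the words of length at most \<open>m\<close> over \<open>l\<close>
  letters.\<close>

lemma sum_powers_le: "(\<Sum>i\<le>m. l ^ i) \<le> (l + 1) ^ m" for l :: nat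
proof (induction m)
  case (Suc m)
  have "l ^ m \<le> (l + 1) ^ m" by (simp add: power_mono)
  then have "l * l ^ m \<le> l * (l + 1) ^ m" by (rule mult_le_mono2)
  with Suc have "(\<Sum>i\<le>m. l ^ i) + l * l ^ m \<le> (l + 1) ^ m + l * (l + 1) ^ m" by (rule add_mono)
  then show ?case unfolding sum.atMost_Suc power_Suc by (simp add: algebra_simps)
qed simp

text \<open>There are at most \<open>2 * (l + 1) ^ (n - 1)\<close> types, each occurring fewer than
  \<open>n\<close> times; the final 1 is for a last fragment without a type.\<close>

lemma fragment_count:
  assumes "fragmented N n (Suc n) ts e" "\<not> divisible n (glue ts e)" "set (glue ts e) \<subseteq> {..<l}"
  shows "length ts \<le> 2 * n * (l + 1) ^ (n - 1) + 1"
proof (cases "ts = []")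
  case False
  let ?U = "{u. set u \<subseteq> {..<l} \<and> length u \<le> n - 1} \<times> (UNIV :: bool set)"
  have "0 < n" using assms(1) False by (cases ts) auto
  have fin: "finite ?U" by (simp add: finite_lists_length_le)
  have "card ?U = (\<Sum>i\<le>n - 1. l ^ i) * 2"
    by (simp add: card_cartesian_product card_lists_length_le)
  also have "\<dots> \<le> (l + 1) ^ (n - 1) * 2" using sum_powers_le by simp
  finally have card: "card ?U \<le> (l + 1) ^ (n - 1) * 2" .
  have "length (fragment_types ts e) = sum (count_list (fragment_types ts e)) ?U"
    using sum_count_set[OF set_fragment_types[OF assms(1,3)] fin] by simp
  also have "\<dots> \<le> card ?U * n"
    using count_fragment_types[OF assms(1,2)] \<open>0 < n\<close>
    by (intro sum_bounded_above[where K = n, simplified]) (fastforce intro: less_imp_le)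
  also have "\<dots> \<le> (l + 1) ^ (n - 1) * 2 * n" using card by (rule mult_le_mono1)
  finally show ?thesis using length_fragment_types[OF assms(1)] by (simp add: algebra_simps)
qed simp

section \<open>Products of lists\<close>

lemma mult_list_single [simp]: "mult_list [x] = x"
  by (simp add: mult_list_def)

lemma mult_foldl: "(x :: 'a::semigroup_mult) * foldl (*) y zs = foldl (*) (x * y) zs"
  by (induction zs arbitrary: y) (auto simp: mult.assoc)

lemma mult_list_append:
  "xs \<noteq> [] \<Longrightarrow> ys \<noteq> [] \<Longrightarrow> mult_list (xs @ ys) = mult_list xs * mult_list ys"
  by (cases xs; cases ys) (auto simp: mult_list_def mult_foldl)

lemma mult_list_Cons: "xs \<noteq> [] \<Longrightarrow> mult_list (x # xs) = x * mult_list xs"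
  using mult_list_append[of "[x]" xs] by simp

lemma mult_list_concat:
  "bs \<noteq> [] \<Longrightarrow> [] \<notin> set bs \<Longrightarrow>
    mult_list (map g (concat bs)) = mult_list (map (\<lambda>b. mult_list (map g b)) bs)"
proof (induction bs)
  case (Cons b bs)
  show ?case
  proof (cases "bs = []")
    case False
    then have "concat bs \<noteq> []" using Cons.prems by (cases bs) auto
    moreover have "b \<noteq> []" using Cons.prems by auto
    ultimately have "mult_list (map g (concat (b # bs)))
        = mult_list (map g b) * mult_list (map g (concat bs))"
      unfolding concat.simps map_append by (intro mult_list_append) (simp_all del: concat_eq_Nil_conv)
    then show ?thesis using Cons False by (simp add: mult_list_Cons)
  qed simp
qed simp

section \<open>Multilinear identities\<close>

text \<open>The index words that arise when \<open>v\<close> is multiplied out after replacing each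
  variable \<open>x\<close> by the sum of all \<open>a i\<close> with
  \<open>\<omega> i = x\<close>.\<close>

definition lifts :: "('i \<Rightarrow> 'b) \<Rightarrow> 'i set \<Rightarrow> 'b list \<Rightarrow> 'i list set" where
  "lifts \<omega> S v = {p. set p \<subseteq> S \<and> map \<omega> p = v}"

lemma finite_lifts: "finite S \<Longrightarrow> finite (lifts \<omega> S v)"
  by (rule finite_subset[of _ "{p. set p \<subseteq> S \<and> length p = length v}"])
     (auto simp: lifts_def finite_lists_length_eq)

lemma lifts_Cons: "lifts \<omega> S (x # v) = (\<lambda>(i, p). i # p) ` ({i \<in> S. \<omega> i = x} \<times> lifts \<omega> S v)"
  by (auto simp: lifts_def image_iff Cons_eq_map_conv map_eq_Cons_conv)

lemma mult_list_map_sum: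
  fixes a :: "'i \<Rightarrow> 'a::ring"
  assumes "finite S" "v \<noteq> []"
  shows "mult_list (map (\<lambda>x. \<Sum>i | i \<in> S \<and> \<omega> i = x. a i) v) = (\<Sum>p\<in>lifts \<omega> S v. mult_list (map a p))"
  using assms(2)
proof (induction v)
  case (Cons x v)
  have lifts_sum: "(\<Sum>p\<in>lifts \<omega> S (x # v). F p) =
      (\<Sum>i | i \<in> S \<and> \<omega> i = x. \<Sum>p\<in>lifts \<omega> S v. F (i # p))" for F :: "_ \<Rightarrow> 'a"
    unfolding lifts_Cons
    by (subst sum.reindex) (auto simp: inj_on_def sum.cartesian_product split_def)
  show ?case
  proof (cases "v = []")
    case True
    have "lifts \<omega> S [] = {[]}" by (auto simp: lifts_def)
    then show ?thesis unfolding lifts_sum by (simp add: True)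
  next
    case False
    then have "p \<noteq> []" if "p \<in> lifts \<omega> S v" for p using that by (auto simp: lifts_def)
    then show ?thesis
      using Cons.IH False by (simp add: lifts_sum mult_list_Cons sum_product cong: sum.cong)
  qed
qed simp

text \<open>Inclusion-exclusion in the form needed to isolate a multilinear component; no signs arise
  because all proper partial sums vanish.\<close>

lemma sum_full_support_eq_0:
  fixes F :: "'i set \<Rightarrow> 'a::comm_monoid_add"
  assumes "finite S" "\<And>T. T \<subseteq> S \<Longrightarrow> (\<Sum>U\<in>Pow T. F U) = 0"
  shows "F S = 0"
  using assms
proof (induction rule: finite_psubset_induct)
  case (psubset S)
  have "F U = 0" if "U \<in> Pow S - {S}" for U
    using that psubset.prems by (intro psubset.IH) auto
  then have "(\<Sum>U\<in>Pow S - {S}. F U) = 0" by (simp add: sum.neutral)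
  moreover have "(\<Sum>U\<in>Pow S. F U) = F S + (\<Sum>U\<in>Pow S - {S}. F U)"
    using psubset.hyps by (intro sum.remove) auto
  ultimately show ?case using psubset.prems[of S] by simp
qed

context assoc_algebra
begin

text \<open>The positions of a highest monomial \<open>w\<close> with coefficient 1 become the new
  variables, and each old variable is replaced by the sum over its positions in \<open>w\<close>.
  The part containing all \<open>n\<close> new variables is multilinear; the identity arrangement
  reads \<open>w\<close> and so has coefficient 1.\<close>

lemma multilinear_identity:
  assumes "admissible f" "polynomial_identity f" "nc_degree f = n"
  shows "\<exists>c. c [0..<n] = 1 \<and> (\<forall>a.
    (\<Sum>p | set p = {..<n} \<and> length p = n. scale (c p) (mult_list (map a p))) = 0)"
proof -
  obtain w where w: "length w = n" "Poly_Mapping.lookup f w = 1" and nc: "nc_polynomial f"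
    using assms unfolding admissible_def by auto
  let ?K = "Poly_Mapping.keys f" and ?L = "Poly_Mapping.lookup f" and ?\<omega> = "(!) w"
  let ?P = "{p. set p = {..<n} \<and> length p = n}"
  have deg: "length v \<le> n" if "v \<in> ?K" for v
    using that assms(3) by (auto simp: nc_degree_def)
  have "(\<Sum>p\<in>?P. scale (?L (map ?\<omega> p)) (mult_list (map a p))) = 0" for a
  proof -
    \<comment> \<open>The part of the expansion whose terms involve exactly the indices in
      \<open>U\<close>.\<close>
    define G where "G U = (\<Sum>v\<in>?K. \<Sum>p | set p = U \<and> map ?\<omega> p = v.
      scale (?L v) (mult_list (map a p)))" for U
    have fin: "finite {p. set p = U \<and> map ?\<omega> p = v}" if "finite U" for U v
      by (rule finite_subset[OF _ finite_lifts[OF that, of ?\<omega> v]]) (auto simp: lifts_def)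
    have "(\<Sum>U\<in>Pow S. G U) = 0" if "S \<subseteq> {..<n}" for S
    proof -
      have S: "finite S" using that finite_subset by blast
      \<comment> \<open>Only indices in \<open>S\<close> enter this substitution, so the value of
        \<open>f\<close> collects the parts \<open>G U\<close> with
        \<open>U \<subseteq> S\<close>.\<close>
      let ?\<sigma> = "\<lambda>x. \<Sum>i | i \<in> S \<and> ?\<omega> i = x. a i"
      have "(\<Sum>U\<in>Pow S. \<Sum>p | set p = U \<and> map ?\<omega> p = v. scale (?L v) (mult_list (map a p)))
          = scale (?L v) (mult_list (map ?\<sigma> v))" if "v \<in> ?K" for v
      proof -
        have "v \<noteq> []" using that nc by (auto simp: nc_polynomial_def)
        have "finite {p. set p = U \<and> map ?\<omega> p = v}" if "U \<in> Pow S" for U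
          using that S by (intro fin) (auto intro: finite_subset)
        moreover have "lifts ?\<omega> S v = (\<Union>U\<in>Pow S. {p. set p = U \<and> map ?\<omega> p = v})"
          by (auto simp: lifts_def)
        ultimately have "(\<Sum>p\<in>lifts ?\<omega> S v. scale (?L v) (mult_list (map a p))) =
          (\<Sum>U\<in>Pow S. \<Sum>p | set p = U \<and> map ?\<omega> p = v. scale (?L v) (mult_list (map a p)))"
          using S by (simp only:) (rule sum.UNION_disjoint; auto)
        then show ?thesis
          using mult_list_map_sum[OF S \<open>v \<noteq> []\<close>, where \<omega> = ?\<omega> and a = a]
          by (simp add: scale_sum_right)
      qed
      then have "(\<Sum>U\<in>Pow S. G U) = nc_eval ?\<sigma> f"
        unfolding G_def nc_eval_def by (subst sum.swap) (rule sum.cong; simp)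
      then show ?thesis using assms(2) by (simp add: polynomial_identity_def)
    qed
    then have "G {..<n} = 0" by (rule sum_full_support_eq_0[OF finite_lessThan])
    moreover have "G {..<n} = (\<Sum>p\<in>?P. scale (?L (map ?\<omega> p)) (mult_list (map a p)))"
    proof -
      let ?U = "\<Union>v\<in>?K. {p. set p = {..<n} \<and> map ?\<omega> p = v}"
      have "G {..<n} = (\<Sum>v\<in>?K. \<Sum>p | set p = {..<n} \<and> map ?\<omega> p = v.
          scale (?L (map ?\<omega> p)) (mult_list (map a p)))"
        unfolding G_def by (intro sum.cong) auto
      also have "\<dots> = (\<Sum>p\<in>?U. scale (?L (map ?\<omega> p)) (mult_list (map a p)))"
        by (rule sum.UNION_disjoint[symmetric]) (auto simp: fin)
      also have "\<dots> = (\<Sum>p\<in>?P. scale (?L (map ?\<omega> p)) (mult_list (map a p)))"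
      proof (rule sum.mono_neutral_left)
        show "finite ?P"
          by (rule finite_subset[OF _ finite_lists_length_eq[of "{..<n}" n]]) auto
        show "?U \<subseteq> ?P"
        proof
          fix p assume "p \<in> ?U"
          then have p: "map ?\<omega> p \<in> ?K" "set p = {..<n}" by auto
          \<comment> \<open>All \<open>n\<close> indices occur and the degree is at most
            \<open>n\<close>, so each occurs exactly once.\<close>
          have "n \<le> length p" using p(2) card_length[of p] by simp
          with deg[OF p(1)] show "p \<in> ?P" using p by simp
        qed
        show "\<forall>p\<in>?P - ?U. scale (?L (map ?\<omega> p)) (mult_list (map a p)) = 0"
          by (auto simp: in_keys_iff)
      qed
      finally show ?thesis .
    qed
    ultimately show ?thesis by simp
  qed
  moreover have "map ?\<omega> [0..<n] = w" using w(1) map_nth by blast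
  ultimately show ?thesis
    using w(2) by (intro exI[of _ "\<lambda>p. ?L (map ?\<omega> p)"]) auto
qed

end

section \<open>Reduction to indivisible words\<close>

text \<open>Before the first moved position all smaller values are already used up, so the entry
  there must be larger.\<close>

lemma first_difference:
  assumes "length p = n" "set p = {..<n}" "p \<noteq> [0..<n]"
  shows "\<exists>i<n. take i p = [0..<i] \<and> i < p ! i \<and> p ! i < n"
proof -
  have "\<exists>i<n. p ! i \<noteq> i" using assms by (metis length_upt map_nth minus_nat.diff_0 nth_equalityI nth_upt plus_nat.add_0)
  then obtain i where i: "i < n" "p ! i \<noteq> i" and least: "\<And>j. j < i \<Longrightarrow> p ! j = j"
    using exists_least_iff[of "\<lambda>i. i < n \<and> p ! i \<noteq> i"] by auto
  have "distinct p" using assms card_distinct[of p] by simp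
  then have "p ! i \<ge> i"
    using least[of "p ! i"] i assms(1) by (metis leI nth_eq_iff_index_eq order.strict_trans)
  moreover have "p ! i < n" using i assms by (metis lessThan_iff nth_mem)
  moreover have "take i p = [0..<i]" using least i assms(1) by (intro nth_equalityI) auto
  ultimately show ?thesis using i by (intro exI[of _ i]) auto
qed

text \<open>At the first moved position a later, hence smaller, factor takes the place of
  \<open>ws ! i\<close>; the total length is unchanged.\<close>

lemma permuted_lex:
  assumes p: "length p = n" "set p = {..<n}" "p \<noteq> [0..<n]"
    and ws: "length ws = n" "sorted_wrt (\<lambda>x y. lex_below y x) ws"
  shows "(d @ concat (map ((!) ws) p), d @ concat ws) \<in> lex less_than"
proof -
  obtain i where i: "i < n" "take i p = [0..<i]" "i < p ! i" "p ! i < n"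
    using first_difference[OF p] by blast
  have "distinct p" using p card_distinct[of p] by simp
  have "map ((!) ws) p = map ((!) ws) (take i p) @ ws ! (p ! i) # map ((!) ws) (drop (Suc i) p)"
    using id_take_nth_drop[of i p] i p by (metis list.simps(9) map_append)
  moreover have "map ((!) ws) (take i p) = take i ws"
    using i ws by (intro nth_equalityI) auto
  moreover have "ws = take i ws @ ws ! i # drop (Suc i) ws"
    using id_take_nth_drop i ws by blast
  moreover have "lex_below (ws ! (p ! i)) (ws ! i)"
    using ws i by (simp add: sorted_wrt_iff_nth_less)
  ultimately have "lex_below (d @ concat (map ((!) ws) p)) (d @ concat ws)"
    using lex_below_append[of "ws ! (p ! i)" "ws ! i" "d @ concat (take i ws)"]
    by (metis append.assoc concat.simps(2) concat_append)
  moreover have "length (concat (map ((!) ws) q)) = (\<Sum>i<n. length (ws ! i))"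
    if "distinct q" "set q = {..<n}" for q
    using that by (simp add: length_concat comp_def sum_list_distinct_conv_sum_set)
  then have "length (concat (map ((!) ws) p)) = length (concat (map ((!) ws) [0..<n]))"
    using \<open>distinct p\<close> p(2) by (simp add: atLeast0LessThan)
  then have "length (concat (map ((!) ws) p)) = length (concat ws)"
    using ws(1) map_nth by metis
  ultimately show ?thesis by (intro lex_below_imp_lex) auto
qed

context assoc_algebra
begin

text \<open>The values of the factors \<open>ws\<close> are put into the multilinear identity, which
  is multiplied by \<open>d\<close> on the left and solved for the term of coefficient 1; the other
  terms are smaller words.\<close>

lemma divisible_word_in_span:
  assumes id: "c [0..<n] = 1"
      "\<And>a. (\<Sum>p | set p = {..<n} \<and> length p = n. scale (c p) (mult_list (map a p))) = 0"
    and W: "divisible n W" and "0 < n"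
    and H: "\<And>V. (V, W) \<in> lex less_than \<Longrightarrow> set V \<subseteq> set W \<Longrightarrow> mult_list (map g V) \<in> span H"
  shows "mult_list (map g W) \<in> span H"
proof -
  obtain d ws where ws: "W = d @ concat ws" "length ws = n" "[] \<notin> set ws"
      "sorted_wrt (\<lambda>x y. lex_below y x) ws" using W unfolding divisible_def by blast
  let ?P = "{p. set p = {..<n} \<and> length p = n}"
  let ?V = "\<lambda>p. d @ concat (map ((!) ws) p)"
  let ?v = "\<lambda>b. mult_list (map g b)"
  have fin: "finite ?P"
    by (rule finite_subset[OF _ finite_lists_length_eq[of "{..<n}" n]]) auto
  have val: "?v (concat (map ((!) ws) p)) = mult_list (map (\<lambda>i. ?v (ws ! i)) p)"
    and ne: "concat (map ((!) ws) p) \<noteq> []" if "p \<in> ?P" for p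
  proof -
    have "p \<noteq> []" using that \<open>0 < n\<close> by auto
    moreover have *: "[] \<notin> set (map ((!) ws) p)"
    proof
      assume "[] \<in> set (map ((!) ws) p)"
      then obtain i where "i \<in> set p" "ws ! i = []" by auto
      moreover have "set p = {..<n}" using that by simp
      ultimately have "i < length ws" "ws ! i = []" using ws(2) by simp_all
      then show False using ws(3) nth_mem by metis
    qed
    ultimately show "?v (concat (map ((!) ws) p)) = mult_list (map (\<lambda>i. ?v (ws ! i)) p)"
      by (subst mult_list_concat) (auto simp: comp_def)
    show "concat (map ((!) ws) p) \<noteq> []" using * \<open>p \<noteq> []\<close> by (cases p) auto
  qed
  have "(\<Sum>p\<in>?P. scale (c p) (?v (concat (map ((!) ws) p)))) = 0"
    unfolding id(2)[of "\<lambda>i. ?v (ws ! i)", symmetric]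
    by (rule sum.cong) (simp_all only: val)
  \<comment> \<open>\<open>mult_list []\<close> is not a unit, so an empty \<open>d\<close> gets its
    own case.\<close>
  moreover have "?v (?V p) = (if d = [] then ?v (concat (map ((!) ws) p))
      else ?v d * ?v (concat (map ((!) ws) p)))" if "p \<in> ?P" for p
    using ne[OF that] by (simp add: mult_list_append)
  then have "(\<Sum>p\<in>?P. scale (c p) (?v (?V p))) = (if d = [] then \<Sum>p\<in>?P. scale (c p) (?v (concat (map ((!) ws) p)))
      else ?v d * (\<Sum>p\<in>?P. scale (c p) (?v (concat (map ((!) ws) p)))))"
    by (auto simp: sum_distrib_left scale_mult_right intro!: sum.cong)
  ultimately have "(\<Sum>p\<in>?P. scale (c p) (?v (?V p))) = 0" by simp
  moreover have "[0..<n] \<in> ?P" by auto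
  ultimately have "scale 1 (?v (?V [0..<n])) + (\<Sum>p\<in>?P - {[0..<n]}. scale (c p) (?v (?V p))) = 0"
    using sum.remove[OF fin, of "[0..<n]" "\<lambda>p. scale (c p) (?v (?V p))"] id(1) by simp
  moreover have "?V [0..<n] = W" using ws map_nth by metis
  ultimately have "?v W = - (\<Sum>p\<in>?P - {[0..<n]}. scale (c p) (?v (?V p)))"
    by (simp add: eq_neg_iff_add_eq_0)
  moreover have "?v (?V p) \<in> span H" if p: "p \<in> ?P - {[0..<n]}" for p
  proof (rule H)
    show "(?V p, W) \<in> lex less_than" using permuted_lex[of p n ws d] p ws by auto
    show "set (?V p) \<subseteq> set W" using p ws by fastforce
  qed
  then have "(\<Sum>p\<in>?P - {[0..<n]}. scale (c p) (?v (?V p))) \<in> span H"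
    by (intro span_sum span_scale)
  ultimately show ?thesis by (simp only: span_neg)
qed

lemma word_in_span_indivisible:
  assumes "admissible f" "polynomial_identity f" "nc_degree f = n" "0 < n"
    and H: "\<And>V. V \<noteq> [] \<Longrightarrow> set V \<subseteq> A \<Longrightarrow> \<not> divisible n V \<Longrightarrow> mult_list (map g V) \<in> span H"
    and "W \<noteq> []" "set W \<subseteq> A"
  shows "mult_list (map g W) \<in> span H"
proof -
  obtain c where c: "c [0..<n] = 1"
      "\<And>a. (\<Sum>p | set p = {..<n} \<and> length p = n. scale (c p) (mult_list (map a p))) = 0"
    using multilinear_identity[OF assms(1-3)] by blast
  \<comment> \<open>\<open>lex\<close> compares only words of equal length, which is why the
    reduction terminates.\<close>
  have "wf (lex less_than)" by (simp add: wf_lex)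
  then show ?thesis using assms(6,7)
  proof (induction W rule: wf_induct_rule)
    case (less W)
    show ?case
    proof (cases "divisible n W")
      case True
      show ?thesis
      proof (rule divisible_word_in_span[OF c True \<open>0 < n\<close>])
        fix V assume V: "(V, W) \<in> lex less_than" "set V \<subseteq> set W"
        then have "V \<noteq> []" by auto
        then show "mult_list (map g V) \<in> span H" using less V by blast
      qed
    qed (use H less.prems in blast)
  qed
qed

text \<open>Concatenation closes the words under products, so by bilinearity their span is a
  subalgebra containing the generators.\<close>

lemma span_words:
  assumes "generated_by (g ` A)"
  shows "span {mult_list (map g W) | W. W \<noteq> [] \<and> set W \<subseteq> A} = UNIV" (is "span ?M = _")
proof -
  have "subalgebra (span ?M)"
    unfolding subalgebra_def
  proof (intro conjI ballI)
    fix x y assume x: "x \<in> span ?M" and y: "y \<in> span ?M"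
    have M: "u * v \<in> span ?M" if uv: "u \<in> ?M" "v \<in> ?M" for u v
    proof -
      from uv obtain U V where *: "u = mult_list (map g U)" "v = mult_list (map g V)"
        "U \<noteq> []" "V \<noteq> []" "set U \<subseteq> A" "set V \<subseteq> A" by blast
      then have "u * v = mult_list (map g (U @ V))" by (simp add: mult_list_append)
      moreover have "U @ V \<noteq> []" "set (U @ V) \<subseteq> A" using * by auto
      ultimately show ?thesis by (intro span_base) blast
    qed
    have uy: "u * y \<in> span ?M" if u: "u \<in> ?M" for u
      using y
    proof (induction rule: span_induct_alt)
      case base
      show ?case by (simp add: span_zero)
    next
      case (step c v z)
      then show ?case
        unfolding distrib_left scale_mult_right[symmetric]
        using M[OF u] by (intro span_add span_scale)
    qed
    show "x * y \<in> span ?M"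
      using x
    proof (induction rule: span_induct_alt)
      case base
      show ?case by (simp add: span_zero)
    next
      case (step c v z)
      then show ?case
        unfolding distrib_right scale_mult_left[symmetric]
        using uy by (intro span_add span_scale)
    qed
  qed simp
  moreover have "g ` A \<subseteq> span ?M"
  proof
    fix x assume "x \<in> g ` A"
    then obtain i where "i \<in> A" and x: "x = mult_list (map g [i])" by auto
    moreover have "[i] \<noteq> []" "set [i] \<subseteq> A" using \<open>i \<in> A\<close> by simp_all
    ultimately have "x \<in> ?M" by (intro CollectI exI[of _ "[i]"] conjI)
    then show "x \<in> span ?M" by (rule span_base)
  qed
  ultimately have "subalgebra hull (g ` A) \<subseteq> span ?M" by (rule hull_minimal[rotated])
  then show ?thesis using assms by (auto simp: generated_by_def)
qed

end

section \<open>Essential height\<close>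

text \<open>Short pieces and powers alternate, with a short piece at both ends; \<open>h\<close>
  powers thus give the \<open>2 * h + 1\<close> factors of \<open>height_products\<close>.\<close>

fun blocks :: "('b list \<times> 'b list \<times> nat) list \<Rightarrow> 'b list \<Rightarrow> 'b list list" where
  "blocks [] e = [e]"
| "blocks ((d, u, j) # ts) e = d # word_power u j # blocks ts e"

lemma concat_blocks: "concat (blocks ts e) = glue ts e"
  by (induction ts e rule: blocks.induct) auto

lemma length_blocks: "length (blocks ts e) = 2 * length ts + 1"
  by (induction ts e rule: blocks.induct) auto

lemma set_blocks:
  "fragmented N n k ts e \<Longrightarrow> b \<in> set (blocks ts e) \<Longrightarrow>
    length b \<le> N \<or> (\<exists>u j. b = word_power u j \<and> u \<noteq> [] \<and> length u < n \<and> k \<le> j)"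
  by (induction ts e rule: blocks.induct) auto

lemma long_blocks:
  "fragmented N n k ts e \<Longrightarrow> length (filter (\<lambda>b. N < length b) (blocks ts e)) \<le> length ts"
  by (induction ts e rule: blocks.induct) auto

lemma pos_power_word:
  assumes "u \<noteq> []" "0 < j"
  shows "mult_list (map g (word_power u j)) = pos_power (mult_list (map g u)) j"
  using mult_list_concat[of "replicate j u" g] assms by (simp add: pos_power_def)

lemma (in assoc_algebra) fragmented_in_height_products:
  assumes "fragmented N n k ts e" "0 < k" "glue ts e \<noteq> []" "set (glue ts e) \<subseteq> {..<l}"
    and "length ts \<le> h"
  shows "mult_list (map g (glue ts e)) \<in> height_products (words_less g l n)
    {mult_list (map g v) | v. set v \<subseteq> {..<l} \<and> length v \<le> N} h"
    (is "_ \<in> height_products ?Y ?D h")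
proof -
  let ?v = "\<lambda>b. mult_list (map g b)"
  have concat_nonempty: "concat (filter (\<lambda>b. b \<noteq> []) bs) = concat bs" for bs :: "nat list list"
    by (induction bs) auto
  \<comment> \<open>In the absence of a unit, empty blocks have to be removed before taking
    values.\<close>
  define bs where "bs = filter (\<lambda>b. b \<noteq> []) (blocks ts e)"
  have concat: "concat bs = glue ts e"
    unfolding bs_def by (simp only: concat_nonempty concat_blocks)
  have "bs \<noteq> []" using concat assms(3) by auto
  have sub: "set b \<subseteq> {..<l}" if "b \<in> set bs" for b
    using that concat assms(4) by (metis UN_upper order_trans set_concat)
  have "?v (glue ts e) = mult_list (map ?v bs)"
    unfolding concat[symmetric] using \<open>bs \<noteq> []\<close> by (intro mult_list_concat) (auto simp: bs_def)
  moreover have "map ?v bs \<noteq> []" using \<open>bs \<noteq> []\<close> by simp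
  moreover have "length (map ?v bs) \<le> 2 * h + 1"
    using length_filter_le[of "\<lambda>b. b \<noteq> []" "blocks ts e"] assms(5) length_blocks[of ts e]
    by (simp add: bs_def)
  moreover have "t \<in> ?D \<or> (\<exists>y\<in>?Y. \<exists>k>0. t = pos_power y k)" if t: "t \<in> set (map ?v bs)" for t
  proof -
    obtain b where b: "b \<in> set bs" "t = ?v b" using t by auto
    then have "b \<in> set (blocks ts e)" by (simp add: bs_def)
    with set_blocks[OF assms(1)] consider "length b \<le> N"
      | u j where "b = word_power u j" "u \<noteq> []" "length u < n" "k \<le> j" by blast
    then show ?thesis
    proof cases
      case 1
      then show ?thesis using b sub by blast
    next
      case 2
      then have "0 < j" using assms(2) by simp
      then have "set u \<subseteq> {..<l}" using sub[OF b(1)] 2(1) by simp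
      then have "?v u \<in> ?Y" using 2 unfolding words_less_def by blast
      then show ?thesis using b 2 pos_power_word[OF 2(2) \<open>0 < j\<close>] \<open>0 < j\<close> by blast
    qed
  qed
  moreover have "card {i. i < length (map ?v bs) \<and> map ?v bs ! i \<notin> ?D} \<le> h"
  proof -
    \<comment> \<open>A value outside \<open>?D\<close> can only come from a block longer than
      \<open>N\<close>, and such a block is a power.\<close>
    have "card {i. i < length (map ?v bs) \<and> map ?v bs ! i \<notin> ?D}
        \<le> card {i. i < length bs \<and> N < length (bs ! i)}"
      by (rule card_mono) (use sub in \<open>auto simp: not_less[symmetric]\<close>)
    also have "\<dots> = length (filter (\<lambda>b. N < length b) bs)"
      by (simp add: length_filter_conv_card)
    also have "\<dots> \<le> length (filter (\<lambda>b. N < length b) (blocks ts e))"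
      unfolding bs_def filter_filter
      by (metis (no_types, lifting) filter_filter length_filter_le filter_cong conj_commute)
    also have "\<dots> \<le> h" using long_blocks[OF assms(1)] assms(5) by simp
    finally show ?thesis .
  qed
  ultimately show ?thesis unfolding height_products_def by blast
qed

lemma finite_words_less: "finite (words_less g l n)"
proof (rule finite_subset)
  show "words_less g l n \<subseteq> (\<lambda>w. mult_list (map g w)) ` {w. set w \<subseteq> {..<l} \<and> length w \<le> n}"
    by (auto simp: words_less_def)
qed (simp add: finite_lists_length_le)

theorem (in assoc_algebra) has_essential_height_words:
  assumes "generated_by (g ` {..<l})" "admissible f" "nc_degree f = n" "polynomial_identity f"
  shows "has_essential_height (words_less g l n) (2 * n * (l + 1) ^ (n - 1) + 1)"
proof -
  let ?Y = "words_less g l n" and ?h = "2 * n * (l + 1) ^ (n - 1) + 1"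
  \<comment> \<open>In degree 0 the monomial with coefficient 1 would be the empty word, which
    \<open>nc_polynomial\<close> forbids.\<close>
  have "0 < n"
    using assms(2,3) unfolding admissible_def nc_polynomial_def
    by (metis gr0I in_keys_iff length_0_conv zero_neq_one)
  obtain N where N: "\<And>W. set W \<subseteq> {..<l} \<Longrightarrow> N \<le> length W \<Longrightarrow>
     divisible n W \<or> (\<exists>u. u \<noteq> [] \<and> length u < n \<and> sublist (word_power u (Suc n)) W)"
    using divisible_or_power[of "Suc n" l n] by blast
  let ?D = "{mult_list (map g v) | v. set v \<subseteq> {..<l} \<and> length v \<le> N}"
  have "?D = (\<lambda>v. mult_list (map g v)) ` {v. set v \<subseteq> {..<l} \<and> length v \<le> N}" by blast
  then have "finite ?D" by (simp add: finite_lists_length_le)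
  have "mult_list (map g V) \<in> span (height_products ?Y ?D ?h)"
    if V: "V \<noteq> []" "set V \<subseteq> {..<l}" "\<not> divisible n V" for V
  proof -
    obtain ts e where ts: "V = glue ts e" "fragmented N n (Suc n) ts e"
      using fragmented_exists[OF N _ V(2,3)] by blast
    have "length ts \<le> ?h" using fragment_count[OF ts(2)] V ts(1) by simp
    then have "mult_list (map g V) \<in> height_products ?Y ?D ?h"
      using fragmented_in_height_products[OF ts(2) zero_less_Suc] V unfolding ts(1) by blast
    then show ?thesis by (rule span_base)
  qed
  then have "mult_list (map g W) \<in> span (height_products ?Y ?D ?h)"
    if "W \<noteq> []" "set W \<subseteq> {..<l}" for W
    using word_in_span_indivisible[OF assms(2,4,3) \<open>0 < n\<close>, of "{..<l}"] that by blast
  then have "span {mult_list (map g W) | W. W \<noteq> [] \<and> set W \<subseteq> {..<l}}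
      \<subseteq> span (height_products ?Y ?D ?h)"
    by (intro span_minimal) auto
  then have "span (height_products ?Y ?D ?h) = UNIV" using span_words[OF assms(1)] by blast
  then show ?thesis
    unfolding has_essential_height_def using \<open>finite ?D\<close> finite_words_less by blast
qed

theorem mainTheorem4:
  fixes scale :: "'r::comm_ring_1 \<Rightarrow> 'a::ring \<Rightarrow> 'a"
    and g :: "nat \<Rightarrow> 'a"
    and f :: "nat list \<Rightarrow>\<^sub>0 'r"
    and n l :: nat
  assumes "assoc_algebra scale"
    and "assoc_algebra.generated_by scale (g ` {..<l})"
    and "admissible f"
    and "nc_degree f = n"
    and "assoc_algebra.polynomial_identity scale f"
  shows "assoc_algebra.essential_height scale (words_less g l n)
           < enat (8 * (l + 1) ^ (n + 1) * n ^ 6)"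
proof -
  interpret assoc_algebra scale by (rule assms(1))
  let ?h = "2 * n * (l + 1) ^ (n - 1) + 1"
  have "has_essential_height (words_less g l n) ?h"
    using has_essential_height_words assms(2-5) by blast
  then have "essential_height (words_less g l n) \<le> enat ?h"
    unfolding essential_height_def by (intro INF_lower) simp
  also have "?h < 8 * (l + 1) ^ (n + 1) * n ^ 6"
  proof -
    have "0 < n"
      using assms(3,4) unfolding admissible_def nc_polynomial_def
      by (metis gr0I in_keys_iff length_0_conv zero_neq_one)
    then have "n * (l + 1) ^ (n - 1) \<le> n ^ 6 * (l + 1) ^ (n + 1)"
      by (intro mult_le_mono power_increasing) (auto intro: self_le_power)
    \<comment> \<open>Positivity absorbs the additive 1: for \<open>x > 0\<close>,
      \<open>2 * x + 1 \<le> 3 * x < 8 * x\<close>.\<close>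
    moreover have "0 < n * (l + 1) ^ (n - 1)" using \<open>0 < n\<close> by simp
    ultimately have "2 * (n * (l + 1) ^ (n - 1)) + 1 < 8 * (n ^ 6 * (l + 1) ^ (n + 1))" by linarith
    then show ?thesis by (simp only: mult.assoc mult.commute mult.left_commute)
  qed
  finally show ?thesis by simp
qed

end
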